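(* There exist absolute constants $c_1>0$ and $0<c_2<1$ such that for every $n\ge 1$ and every ellipsoid $E$ in $\mathbf{R}^n$ with $M_E<c_2$, $$|E\cap\mathbf{Z}^n|\ \ge\ \max_m\left\{d\left(\frac{c_2}{\sqrt m\,M_E},m\right):m\le c_1\sqrt n\right\}\ \ge\ \max_m\left\{\binom{m}{[c_2^2/(mM_E^2)]}2^{[c_2^2/(mM_E^2)]}:m\le c_1\sqrt n\right\},$$ where $m$ ranges over positive integers (nothing is asserted if there is no positive integer $m\le c_1\sqrt n$).
   Context: $\mathbf{R}^n$ is equipped with the standard Euclidean structure, unit ball $D_n$ and unit sphere $S^{n-1}$; $\mathbf{Z}^n$ is the integer lattice with respect to the fixed orthonormal coordinate system. Ellipsoids are non-degenerate and origin-centred. $M_E=\left(\int_{S^{n-1}}\|x\|_E^2\,d\mu(x)\right)^{1/2}$, where $\|\cdot\|_E$ is the norm with unit ball $E$ and $\mu$ is the rotationally invariant probability measure on $S^{n-1}$. $|A|$ denotes the cardinality of a finite set $A$, $[\cdot]$ the integer part, and $d(t,m)=|tD_m\cap\mathbf{Z}^m|$ is the number of integer points in the $m$-dimensional Euclidean ball of radius $t$. Binomial coefficients $\binom{a}{b}$ with $b>a$ are $0$. *)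

theory Defs
  imports "HOL-Probability.Probability"
begin

text \<open>
  The dimension \<open>n\<close> is quantified inside the scope of the absolute constants, so it cannot be
  a type index. Euclidean \<open>n\<close>-space is the space of extensional functions on \<open>{..<n}\<close>; it is the
  underlying space of the library's product measures over \<open>{..<n}\<close>, and its Euclidean
  norm is \<^const>\<open>L2_set\<close>.
\<close>

definition Rn :: "nat \<Rightarrow> (nat \<Rightarrow> real) set" where
  "Rn n = (\<Pi>\<^sub>E i\<in>{..<n}. UNIV)"

definition Zn :: "nat \<Rightarrow> (nat \<Rightarrow> real) set" where
  "Zn n = (\<Pi>\<^sub>E i\<in>{..<n}. \<int>)"

abbreviation enorm :: "nat \<Rightarrow> (nat \<Rightarrow> real) \<Rightarrow> real" where
  "enorm n x \<equiv> L2_set x {..<n}"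

definition eball :: "nat \<Rightarrow> real \<Rightarrow> (nat \<Rightarrow> real) set" where
  "eball n t = {x \<in> Rn n. enorm n x \<le> t}"

definition esphere :: "nat \<Rightarrow> (nat \<Rightarrow> real) set" where
  "esphere n = {x \<in> Rn n. enorm n x = 1}"

definition mat_app :: "nat \<Rightarrow> (nat \<Rightarrow> nat \<Rightarrow> real) \<Rightarrow> (nat \<Rightarrow> real) \<Rightarrow> nat \<Rightarrow> real" where
  "mat_app n A x = (\<lambda>i\<in>{..<n}. \<Sum>j<n. A i j * x j)"

definition orthogonal_mat :: "nat \<Rightarrow> (nat \<Rightarrow> nat \<Rightarrow> real) \<Rightarrow> bool" where
  "orthogonal_mat n Q \<longleftrightarrow>
     (\<forall>i<n. \<forall>j<n. (\<Sum>k<n. Q k i * Q k j) = (if i = j then 1 else 0)) \<and>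
     (\<forall>i<n. \<forall>j<n. (\<Sum>k<n. Q i k * Q j k) = (if i = j then 1 else 0))"

definition is_ellipsoid :: "nat \<Rightarrow> (nat \<Rightarrow> real) set \<Rightarrow> bool" where
  "is_ellipsoid n E \<longleftrightarrow>
     (\<exists>A. bij_betw (mat_app n A) (Rn n) (Rn n) \<and> E = mat_app n A ` eball n 1)"

text \<open>The norm whose unit ball is \<open>E\<close>, as the Minkowski functional of \<open>E\<close>.\<close>

definition norm_of :: "nat \<Rightarrow> (nat \<Rightarrow> real) set \<Rightarrow> (nat \<Rightarrow> real) \<Rightarrow> real" where
  "norm_of n E x = Inf {r. 0 < r \<and> (\<lambda>i\<in>{..<n}. x i / r) \<in> E}"

text \<open>
  Invariance is under the full orthogonal group: for \<open>n = 1\<close> the special orthogonal group is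
  trivial and would not determine the measure on the two-point sphere.
\<close>

definition rotation_invariant_prob :: "nat \<Rightarrow> (nat \<Rightarrow> real) measure \<Rightarrow> bool" where
  "rotation_invariant_prob n \<mu> \<longleftrightarrow>
     prob_space \<mu> \<and>
     sets \<mu> = sets (restrict_space (\<Pi>\<^sub>M i\<in>{..<n}. borel) (esphere n)) \<and>
     (\<forall>Q. orthogonal_mat n Q \<longrightarrow> distr \<mu> \<mu> (mat_app n Q) = \<mu>)"

definition M_of :: "nat \<Rightarrow> (nat \<Rightarrow> real) measure \<Rightarrow> (nat \<Rightarrow> real) set \<Rightarrow> real" where
  "M_of n \<mu> E = sqrt (\<integral>x. (norm_of n E x)\<^sup>2 \<partial>\<mu>)"

definition ball_count :: "real \<Rightarrow> nat \<Rightarrow> nat" where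
  "ball_count t m = card (eball m t \<inter> Zn m)"


text \<open>
  The remainder shows that a rotation invariant probability measure on the sphere exists:
  the image of normalized Lebesgue measure on the punctured ball under \<open>x \<mapsto> x / |x|\<close>.
\<close>

abbreviation leb :: "nat \<Rightarrow> (nat \<Rightarrow> real) measure" where
  "leb n \<equiv> \<Pi>\<^sub>M i\<in>{..<n}. lborel"

lemma space_leb: "space (leb n) = Rn n"
  by (simp add: space_PiM Rn_def)

lemma sets_leb: "sets (leb n) = sets (\<Pi>\<^sub>M i\<in>{..<n}. borel)"
  by (intro sets_PiM_cong) auto

lemma psf_leb: "product_sigma_finite (\<lambda>i. lborel :: real measure)"
  by unfold_locales

lemma sigma_finite_leb: "sigma_finite_measure (leb n)"
  by (rule product_sigma_finite.sigma_finite[OF psf_leb]) simp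

lemma pair_leb: "pair_sigma_finite (leb n) (leb n)"
  using sigma_finite_leb by (simp add: pair_sigma_finite_def)

lemma comp_meas [measurable]: "i < n \<Longrightarrow> (\<lambda>x. x i) \<in> borel_measurable (leb n)"
  by (metis lessThan_iff measurable_component_singleton measurable_lborel1)

lemma enorm_meas [measurable]: "enorm n \<in> borel_measurable (leb n)"
proof -
  have [measurable]: "(\<lambda>x. \<Sum>i<n. (x i)\<^sup>2) \<in> borel_measurable (leb n)"
    by (intro borel_measurable_sum borel_measurable_power comp_meas) auto
  have "(\<lambda>x. sqrt (\<Sum>i<n. (x i)\<^sup>2)) \<in> borel_measurable (leb n)"
    by measurable
  then show ?thesis by (simp add: L2_set_def[abs_def])
qed

lemma restrict_leb_meas:
  assumes "\<And>i. i < n \<Longrightarrow> f i \<in> borel_measurable N"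
  shows "(\<lambda>x. \<lambda>i\<in>{..<n}. f i x) \<in> measurable N (leb n)"
  using assms by (intro measurable_restrict) auto

lemma mat_app_meas [measurable]: "mat_app n A \<in> measurable (leb n) (leb n)"
  unfolding mat_app_def
  by (intro restrict_leb_meas borel_measurable_sum borel_measurable_times comp_meas) auto

definition vadd :: "nat \<Rightarrow> (nat \<Rightarrow> real) \<Rightarrow> (nat \<Rightarrow> real) \<Rightarrow> nat \<Rightarrow> real" where
  "vadd n x y = (\<lambda>i\<in>{..<n}. x i + y i)"

definition vneg :: "nat \<Rightarrow> (nat \<Rightarrow> real) \<Rightarrow> nat \<Rightarrow> real" where
  "vneg n x = (\<lambda>i\<in>{..<n}. - x i)"

lemma vadd_meas:
  assumes "f \<in> measurable N (leb n)" "g \<in> measurable N (leb n)"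
  shows "(\<lambda>x. vadd n (f x) (g x)) \<in> measurable N (leb n)"
  unfolding vadd_def
  by (intro restrict_leb_meas borel_measurable_add measurable_compose[OF assms(1) comp_meas]
        measurable_compose[OF assms(2) comp_meas]) auto

lemma vneg_meas:
  assumes "f \<in> measurable N (leb n)"
  shows "(\<lambda>x. vneg n (f x)) \<in> measurable N (leb n)"
  unfolding vneg_def
  by (intro restrict_leb_meas borel_measurable_uminus measurable_compose[OF assms(1) comp_meas]) auto

lemma Rn_simps [simp]: "vadd n x y \<in> Rn n" "vneg n x \<in> Rn n" "mat_app n A x \<in> Rn n"
  by (auto simp: vadd_def vneg_def mat_app_def Rn_def)

lemma leb_translate:
  "distr (leb n) (leb n) (\<lambda>x. vadd n x a) = leb n"
proof (rule product_sigma_finite.PiM_eqI[OF psf_leb])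
  fix A :: "nat \<Rightarrow> real set" assume A: "\<And>i. i \<in> {..<n} \<Longrightarrow> A i \<in> sets lborel"
  have S: "Pi\<^sub>E {..<n} A \<in> sets (leb n)"
    using A by (intro sets_PiM_I_finite) auto
  have m: "(\<lambda>x. vadd n x a) \<in> measurable (leb n) (leb n)"
    unfolding vadd_def
    by (intro restrict_leb_meas borel_measurable_add comp_meas) auto
  have eq: "(\<lambda>x. vadd n x a) -` Pi\<^sub>E {..<n} A \<inter> space (leb n) =
            (\<Pi>\<^sub>E i\<in>{..<n}. (\<lambda>t. t + a i) -` A i)"
    by (auto simp: space_leb Rn_def vadd_def PiE_def Pi_def)
  have shift: "(\<lambda>t. t + a i) -` A i \<in> sets lborel \<and>
      emeasure lborel ((\<lambda>t. t + a i) -` A i) = emeasure lborel (A i)" if "i < n" for i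
  proof -
    have Ai: "A i \<in> sets borel" using A that by auto
    have mt: "(\<lambda>t::real. t + a i) \<in> borel \<rightarrow>\<^sub>M borel" by measurable
    have 1: "(\<lambda>t. t + a i) -` A i \<in> sets borel"
      using measurable_sets[OF mt Ai] by simp
    have "emeasure lborel (A i) = emeasure (distr lborel borel ((+) (a i))) (A i)"
      by (simp add: lborel_distr_plus)
    also have "\<dots> = emeasure lborel ((+) (a i) -` A i \<inter> space lborel)"
      using Ai by (intro emeasure_distr) auto
    also have "(+) (a i) -` A i \<inter> space lborel = (\<lambda>t. t + a i) -` A i"
      by (auto simp: add.commute)
    finally show ?thesis using 1 by simp
  qed
  have "emeasure (distr (leb n) (leb n) (\<lambda>x. vadd n x a)) (Pi\<^sub>E {..<n} A) =
        emeasure (leb n) (\<Pi>\<^sub>E i\<in>{..<n}. (\<lambda>t. t + a i) -` A i)"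
    by (simp add: emeasure_distr[OF m S] eq)
  also have "\<dots> = (\<Prod>i\<in>{..<n}. emeasure lborel ((\<lambda>t. t + a i) -` A i))"
    using shift by (intro product_sigma_finite.emeasure_PiM[OF psf_leb]) auto
  also have "\<dots> = (\<Prod>i\<in>{..<n}. emeasure lborel (A i))"
    using shift by (intro prod.cong) auto
  finally show "emeasure (distr (leb n) (leb n) (\<lambda>x. vadd n x a)) (Pi\<^sub>E {..<n} A) =
      (\<Prod>i\<in>{..<n}. emeasure lborel (A i))" .
qed auto

lemma nn_translate:
  assumes "f \<in> borel_measurable (leb n)"
  shows "(\<integral>\<^sup>+x. f (vadd n x a) \<partial>leb n) = (\<integral>\<^sup>+x. f x \<partial>leb n)"
proof -
  have m: "(\<lambda>x. vadd n x a) \<in> measurable (leb n) (leb n)"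
    unfolding vadd_def
    by (intro restrict_leb_meas borel_measurable_add comp_meas) auto
  show ?thesis
    using nn_integral_distr[OF m, of f] assms by (simp add: leb_translate)
qed

definition tmat :: "(nat \<Rightarrow> nat \<Rightarrow> real) \<Rightarrow> nat \<Rightarrow> nat \<Rightarrow> real" where
  "tmat Q i j = Q j i"

lemma mat_app_vadd: "mat_app n Q (vadd n x y) = vadd n (mat_app n Q x) (mat_app n Q y)"
  by (auto simp: mat_app_def vadd_def fun_eq_iff restrict_def distrib_left sum.distrib)

lemma mat_app_tmat:
  assumes "orthogonal_mat n Q" "x \<in> Rn n"
  shows "mat_app n Q (mat_app n (tmat Q) x) = x"
proof
  fix i
  show "mat_app n Q (mat_app n (tmat Q) x) i = x i"
  proof (cases "i < n")
    case True
    have "mat_app n Q (mat_app n (tmat Q) x) i = (\<Sum>j<n. Q i j * (\<Sum>k<n. Q k j * x k))"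
      using True by (simp add: mat_app_def tmat_def)
    also have "\<dots> = (\<Sum>j<n. \<Sum>k<n. Q i j * Q k j * x k)"
      by (simp add: sum_distrib_left mult.assoc)
    also have "\<dots> = (\<Sum>k<n. \<Sum>j<n. Q i j * Q k j * x k)" by (rule sum.swap)
    also have "\<dots> = (\<Sum>k<n. (\<Sum>j<n. Q i j * Q k j) * x k)"
      by (simp add: sum_distrib_right)
    also have "\<dots> = (\<Sum>k<n. (if i = k then 1 else 0) * x k)"
      using assms(1) True by (intro sum.cong) (auto simp: orthogonal_mat_def)
    also have "\<dots> = (\<Sum>k<n. if i = k then x k else 0)" by (intro sum.cong) auto
    also have "\<dots> = x i" using True by simp
    finally show ?thesis .
  next
    case False
    then show ?thesis using assms(2) by (auto simp: mat_app_def Rn_def PiE_def extensional_def)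
  qed
qed

lemma enorm_mat_app:
  assumes "orthogonal_mat n Q"
  shows "enorm n (mat_app n Q x) = enorm n x"
proof -
  have "(\<Sum>i<n. (mat_app n Q x i)\<^sup>2) = (\<Sum>i<n. \<Sum>j<n. \<Sum>k<n. Q i j * Q i k * (x j * x k))"
    by (simp add: mat_app_def power2_eq_square sum_product mult_ac)
  also have "\<dots> = (\<Sum>j<n. \<Sum>i<n. \<Sum>k<n. Q i j * Q i k * (x j * x k))" by (rule sum.swap)
  also have "\<dots> = (\<Sum>j<n. \<Sum>k<n. \<Sum>i<n. Q i j * Q i k * (x j * x k))"
    by (intro sum.cong refl sum.swap)
  also have "\<dots> = (\<Sum>j<n. \<Sum>k<n. (\<Sum>i<n. Q i j * Q i k) * (x j * x k))"
    by (simp add: sum_distrib_right)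
  also have "\<dots> = (\<Sum>j<n. \<Sum>k<n. (if j = k then 1 else 0) * (x j * x k))"
    using assms by (intro sum.cong) (auto simp: orthogonal_mat_def)
  also have "\<dots> = (\<Sum>j<n. \<Sum>k<n. if j = k then x j * x k else 0)"
    by (intro sum.cong) auto
  also have "\<dots> = (\<Sum>j<n. (x j)\<^sup>2)" by (simp add: power2_eq_square)
  finally show ?thesis by (simp add: L2_set_def)
qed

definition pball :: "nat \<Rightarrow> (nat \<Rightarrow> real) set" where
  "pball n = {x \<in> Rn n. 0 < enorm n x \<and> enorm n x \<le> 1}"

lemma pball_sets [measurable]: "pball n \<in> sets (leb n)"
proof -
  have "{x \<in> space (leb n). 0 < enorm n x \<and> enorm n x \<le> 1} \<in> sets (leb n)" by measurable
  then show ?thesis by (simp add: pball_def space_leb)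
qed

lemma pball_pos:
  assumes "1 \<le> n" shows "emeasure (leb n) (pball n) \<noteq> 0"
proof -
  let ?B = "\<Pi>\<^sub>E i\<in>{..<n}. {0<..1 / real n}"
  have sub: "?B \<subseteq> pball n"
  proof
    fix x assume x: "x \<in> ?B"
    have b: "0 < x i" "x i \<le> 1 / real n" if "i < n" for i
      using x that by (auto simp: PiE_def Pi_def)
    have "enorm n x \<le> (\<Sum>i<n. x i)" using b by (intro L2_set_le_sum) (auto simp: less_imp_le)
    also have "\<dots> \<le> (\<Sum>i<n. 1 / real n)" using b by (intro sum_mono) auto
    also have "\<dots> = 1" using assms by simp
    finally have "enorm n x \<le> 1" .
    moreover have "x 0 \<le> enorm n x" using assms by (intro member_le_L2_set) auto
    moreover have "x \<in> Rn n" using x by (auto simp: Rn_def PiE_def)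
    ultimately show "x \<in> pball n" using b[of 0] assms by (auto simp: pball_def)
  qed
  have "emeasure (leb n) ?B = (\<Prod>i\<in>{..<n}. emeasure lborel {0<..1 / real n})"
    by (intro product_sigma_finite.emeasure_PiM[OF psf_leb]) auto
  also have "\<dots> = (\<Prod>i\<in>{..<n}. ennreal (1 / real n))" by simp
  also have "\<dots> \<noteq> 0" using assms by auto
  finally have "emeasure (leb n) ?B \<noteq> 0" .
  then show ?thesis using emeasure_mono[OF sub pball_sets] by auto
qed

lemma pball_finite: "emeasure (leb n) (pball n) \<noteq> \<infinity>"
proof -
  let ?B = "\<Pi>\<^sub>E i\<in>{..<n}. {-1..1::real}"
  have sub: "pball n \<subseteq> ?B"
  proof
    fix x assume x: "x \<in> pball n"
    have "\<bar>x i\<bar> \<le> 1" if "i < n" for i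
    proof -
      have "\<bar>x i\<bar> \<le> enorm n (\<lambda>i. \<bar>x i\<bar>)"
        using that by (intro member_le_L2_set) auto
      also have "\<dots> = enorm n x" by (simp add: L2_set_def)
      finally show ?thesis using x by (auto simp: pball_def)
    qed
    then show "x \<in> ?B" using x
      by (auto simp: pball_def Rn_def PiE_iff abs_le_iff minus_le_iff)
  qed
  have "emeasure (leb n) ?B = (\<Prod>i\<in>{..<n}. emeasure lborel {-1..1::real})"
    by (intro product_sigma_finite.emeasure_PiM[OF psf_leb]) auto
  also have "\<dots> = (\<Prod>i\<in>{..<n}. ennreal 2)" by simp
  also have "\<dots> < \<infinity>" by (simp add: power_less_top_ennreal)
  finally have B: "emeasure (leb n) ?B < \<infinity>" .
  have "?B \<in> sets (leb n)" by (intro sets_PiM_I_finite) auto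
  from emeasure_mono[OF sub this] B show ?thesis by auto
qed

lemma leb_rotate:
  assumes n: "1 \<le> n" and Q: "orthogonal_mat n Q" and B: "B \<in> sets (leb n)"
  shows "emeasure (leb n) (mat_app n Q -` B \<inter> Rn n) = emeasure (leb n) B"
proof -
  interpret pair_sigma_finite "leb n" "leb n" by (rule pair_leb)
  let ?L = "leb n" and ?Q = "mat_app n Q" and ?R = "mat_app n (tmat Q)"
  let ?A = "pball n"
  let ?f = "indicator ?A :: _ \<Rightarrow> ennreal" and ?g = "indicator B :: _ \<Rightarrow> ennreal"
  have mf [measurable]: "?f \<in> borel_measurable ?L" by measurable
  have mg [measurable]: "?g \<in> borel_measurable ?L" using B by measurable
  have mgQ [measurable]: "(\<lambda>y. ?g (?Q y)) \<in> borel_measurable ?L"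
    by (rule measurable_compose[OF mat_app_meas mg])
  have pre: "?Q -` B \<inter> Rn n \<in> sets ?L"
    using measurable_sets[OF mat_app_meas B, of Q] by (simp add: space_leb)
  have preI: "(\<integral>\<^sup>+y. ?g (?Q y) \<partial>?L) = emeasure ?L (?Q -` B \<inter> Rn n)"
  proof -
    have "(\<integral>\<^sup>+y. ?g (?Q y) \<partial>?L) = (\<integral>\<^sup>+y. indicator (?Q -` B \<inter> Rn n) y \<partial>?L)"
      by (intro nn_integral_cong) (auto simp: space_leb indicator_def)
    then show ?thesis using pre by simp
  qed
  have AQ: "?f (vadd n x (vneg n (?Q (vadd n y (?R x))))) = ?f y"
    if "x \<in> Rn n" "y \<in> Rn n" for x y
  proof -
    have "vadd n x (vneg n (?Q (vadd n y (?R x)))) = vneg n (?Q y)"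
      using that by (simp add: mat_app_vadd mat_app_tmat[OF Q])
        (auto simp: vadd_def vneg_def fun_eq_iff)
    moreover have "enorm n (vneg n z) = enorm n z" for z
      by (simp add: L2_set_def vneg_def)
    ultimately show ?thesis
      using that enorm_mat_app[OF Q] by (auto simp: pball_def indicator_def)
  qed
  have BQ: "?Q (vadd n y (?R x)) = vadd n x (?Q y)" if "x \<in> Rn n" for x y
    using that by (simp add: mat_app_vadd mat_app_tmat[OF Q]) (auto simp: vadd_def)
  have mQ2: "(\<lambda>p. ?Q (snd p)) \<in> measurable (?L \<Otimes>\<^sub>M ?L) ?L"
    by (rule measurable_compose[OF measurable_snd mat_app_meas])
  have mf1: "(\<lambda>p. ?f (fst p)) \<in> borel_measurable (?L \<Otimes>\<^sub>M ?L)"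
    by (rule measurable_compose[OF measurable_fst mf])
  have mg1: "(\<lambda>p. ?g (fst p)) \<in> borel_measurable (?L \<Otimes>\<^sub>M ?L)"
    by (rule measurable_compose[OF measurable_fst mg])
  have m1: "(\<lambda>(x, y). ?f x * ?g (vadd n x (?Q y))) \<in> borel_measurable (?L \<Otimes>\<^sub>M ?L)"
    unfolding split_beta
    using borel_measurable_times_ennreal[OF mf1
        measurable_compose[OF vadd_meas[OF measurable_fst mQ2] mg]] .
  have m2: "(\<lambda>(x, y). ?f (vadd n x (vneg n (?Q y))) * ?g x) \<in> borel_measurable (?L \<Otimes>\<^sub>M ?L)"
    unfolding split_beta
    using borel_measurable_times_ennreal[OF
        measurable_compose[OF vadd_meas[OF measurable_fst vneg_meas[OF mQ2]] mf] mg1] .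
  have m3: "(\<lambda>x. ?f (vadd n x (vneg n (?Q y))) * ?g x) \<in> borel_measurable ?L" for y
  proof -
    have c: "(\<lambda>x. vneg n (?Q y)) \<in> measurable ?L ?L"
      by (rule measurable_const) (simp add: space_leb)
    show ?thesis
      using borel_measurable_times_ennreal[OF
          measurable_compose[OF vadd_meas[OF measurable_ident_sets[OF refl] c] mf] mg] .
  qed
  have m4: "(\<lambda>y. ?f (vadd n x (vneg n (?Q y))) * ?g x) \<in> borel_measurable ?L"
    if "x \<in> Rn n" for x
  proof -
    have c: "(\<lambda>y. x) \<in> measurable ?L ?L"
      using that by (intro measurable_const) (simp add: space_leb)
    show ?thesis
      using borel_measurable_times_ennreal[OF
          measurable_compose[OF vadd_meas[OF c vneg_meas[OF mat_app_meas]] mf]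
          borel_measurable_const] .
  qed
  have m5: "(\<lambda>y. ?g (vadd n x (?Q y))) \<in> borel_measurable ?L"
    if "x \<in> Rn n" for x
  proof -
    have c: "(\<lambda>y. x) \<in> measurable ?L ?L"
      using that by (intro measurable_const) (simp add: space_leb)
    show ?thesis
      using measurable_compose[OF vadd_meas[OF c mat_app_meas] mg] .
  qed
  have "emeasure ?L ?A * emeasure ?L (?Q -` B \<inter> Rn n) =
        (\<integral>\<^sup>+x. ?f x * (\<integral>\<^sup>+y. ?g (?Q y) \<partial>?L) \<partial>?L)"
    by (simp add: preI nn_integral_multc)
  also have "\<dots> = (\<integral>\<^sup>+x. ?f x * (\<integral>\<^sup>+y. ?g (?Q (vadd n y (?R x))) \<partial>?L) \<partial>?L)"
    using nn_translate[OF mgQ] by simp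
  also have "\<dots> = (\<integral>\<^sup>+x. (\<integral>\<^sup>+y. ?f x * ?g (vadd n x (?Q y)) \<partial>?L) \<partial>?L)"
  proof (rule nn_integral_cong)
    fix x assume x: "x \<in> space ?L"
    show "?f x * (\<integral>\<^sup>+y. ?g (?Q (vadd n y (?R x))) \<partial>?L) =
          (\<integral>\<^sup>+y. ?f x * ?g (vadd n x (?Q y)) \<partial>?L)"
      using x by (subst nn_integral_cmult[OF m5]) (simp_all add: BQ space_leb)
  qed
  also have "\<dots> = (\<integral>\<^sup>+y. (\<integral>\<^sup>+x. ?f x * ?g (vadd n x (?Q y)) \<partial>?L) \<partial>?L)"
    by (rule Fubini'[OF m1, symmetric])
  also have "\<dots> = (\<integral>\<^sup>+y. (\<integral>\<^sup>+x. ?f (vadd n x (vneg n (?Q y))) * ?g x \<partial>?L) \<partial>?L)"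
  proof (rule nn_integral_cong)
    fix y assume y: "y \<in> space ?L"
    have "(\<integral>\<^sup>+x. ?f (vadd n x (vneg n (?Q y))) * ?g x \<partial>?L) =
          (\<integral>\<^sup>+x. ?f (vadd n (vadd n x (?Q y)) (vneg n (?Q y))) * ?g (vadd n x (?Q y)) \<partial>?L)"
      by (rule nn_translate[OF m3, symmetric])
    also have "\<dots> = (\<integral>\<^sup>+x. ?f x * ?g (vadd n x (?Q y)) \<partial>?L)"
    proof (rule nn_integral_cong)
      fix x assume x: "x \<in> space ?L"
      have "vadd n (vadd n x (?Q y)) (vneg n (?Q y)) = x"
        using x by (auto simp: space_leb Rn_def vadd_def vneg_def fun_eq_iff PiE_def extensional_def)
      then show "?f (vadd n (vadd n x (?Q y)) (vneg n (?Q y))) * ?g (vadd n x (?Q y)) =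
          ?f x * ?g (vadd n x (?Q y))" by simp
    qed
    finally show "(\<integral>\<^sup>+x. ?f x * ?g (vadd n x (?Q y)) \<partial>?L) =
        (\<integral>\<^sup>+x. ?f (vadd n x (vneg n (?Q y))) * ?g x \<partial>?L)" by simp
  qed
  also have "\<dots> = (\<integral>\<^sup>+x. (\<integral>\<^sup>+y. ?f (vadd n x (vneg n (?Q y))) * ?g x \<partial>?L) \<partial>?L)"
    by (rule Fubini'[OF m2])
  also have "\<dots> = (\<integral>\<^sup>+x. (\<integral>\<^sup>+y. ?f y * ?g x \<partial>?L) \<partial>?L)"
  proof (rule nn_integral_cong)
    fix x assume x: "x \<in> space ?L"
    then have xr: "x \<in> Rn n" by (simp add: space_leb)
    have "(\<integral>\<^sup>+y. ?f (vadd n x (vneg n (?Q y))) * ?g x \<partial>?L) =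
          (\<integral>\<^sup>+y. ?f (vadd n x (vneg n (?Q (vadd n y (?R x))))) * ?g x \<partial>?L)"
      by (rule nn_translate[OF m4[OF xr], symmetric])
    also have "\<dots> = (\<integral>\<^sup>+y. ?f y * ?g x \<partial>?L)"
      by (intro nn_integral_cong) (simp add: AQ xr space_leb)
    finally show "(\<integral>\<^sup>+y. ?f (vadd n x (vneg n (?Q y))) * ?g x \<partial>?L) = (\<integral>\<^sup>+y. ?f y * ?g x \<partial>?L)" .
  qed
  also have "\<dots> = emeasure ?L ?A * emeasure ?L B"
    using B by (simp add: nn_integral_multc nn_integral_cmult)
  finally show ?thesis
    using pball_pos[OF n] pball_finite[of n] by (simp add: ennreal_mult_cancel_left)
qed

definition normalize_vec :: "nat \<Rightarrow> (nat \<Rightarrow> real) \<Rightarrow> nat \<Rightarrow> real" where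
  "normalize_vec n x = (\<lambda>i\<in>{..<n}.
     if enorm n x = 0 then (if i = 0 then 1 else 0) else x i / enorm n x)"

lemma normalize_vec_esphere:
  assumes "1 \<le> n" shows "normalize_vec n x \<in> esphere n"
proof -
  have "(\<Sum>i<n. (normalize_vec n x i)\<^sup>2) = 1"
  proof (cases "enorm n x = 0")
    case True
    have "(\<Sum>i<n. (normalize_vec n x i)\<^sup>2) = (\<Sum>i<n. if i = 0 then 1 else 0)"
      using True by (intro sum.cong) (auto simp: normalize_vec_def)
    then show ?thesis using assms by simp
  next
    case False
    have "(enorm n x)\<^sup>2 = (\<Sum>i<n. (x i)\<^sup>2)" by (simp add: L2_set_def sum_nonneg)
    moreover have "(\<Sum>i<n. (normalize_vec n x i)\<^sup>2) = (\<Sum>i<n. (x i)\<^sup>2) / (enorm n x)\<^sup>2"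
      using False by (simp add: normalize_vec_def power_divide sum_divide_distrib)
    moreover have "(enorm n x)\<^sup>2 \<noteq> 0" using False by simp
    ultimately show ?thesis by (metis divide_self)
  qed
  then show ?thesis by (simp add: esphere_def L2_set_def Rn_def normalize_vec_def)
qed

lemma normalize_vec_mat_app:
  assumes "orthogonal_mat n Q" "enorm n x \<noteq> 0"
  shows "normalize_vec n (mat_app n Q x) = mat_app n Q (normalize_vec n x)"
proof -
  have "enorm n (mat_app n Q x) \<noteq> 0" using assms by (simp add: enorm_mat_app)
  then have "normalize_vec n (mat_app n Q x) = (\<lambda>i\<in>{..<n}. mat_app n Q x i / enorm n x)"
    using assms by (simp add: normalize_vec_def enorm_mat_app)
  also have "\<dots> = mat_app n Q (normalize_vec n x)"
    using assms by (auto simp: normalize_vec_def mat_app_def fun_eq_iff sum_divide_distrib)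
  finally show ?thesis .
qed

abbreviation sphere_space :: "nat \<Rightarrow> (nat \<Rightarrow> real) measure" where
  "sphere_space n \<equiv> restrict_space (\<Pi>\<^sub>M i\<in>{..<n}. borel) (esphere n)"

lemma space_sphere_space: "space (sphere_space n) = esphere n"
  by (auto simp: space_restrict_space space_PiM esphere_def Rn_def)

lemma mat_app_sphere:
  assumes "orthogonal_mat n Q"
  shows "mat_app n Q \<in> measurable (sphere_space n) (sphere_space n)"
proof (rule measurable_restrict_space3)
  show "mat_app n Q \<in> (\<Pi>\<^sub>M i\<in>{..<n}. borel) \<rightarrow>\<^sub>M (\<Pi>\<^sub>M i\<in>{..<n}. borel)"
    using mat_app_meas[of n Q] by (simp cong: measurable_cong_sets add: sets_leb)
  show "mat_app n Q \<in> esphere n \<rightarrow> esphere n"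
    using enorm_mat_app[OF assms] by (auto simp: esphere_def)
qed

lemma normalize_vec_meas:
  assumes "1 \<le> n"
  shows "normalize_vec n \<in> measurable (leb n) (sphere_space n)"
proof (rule measurable_restrict_space2)
  show "normalize_vec n \<in> space (leb n) \<rightarrow> esphere n"
    using normalize_vec_esphere[OF assms] by auto
  have "normalize_vec n \<in> measurable (leb n) (leb n)"
    unfolding normalize_vec_def
    by (intro restrict_leb_meas measurable_If borel_measurable_divide comp_meas enorm_meas) measurable
  then show "normalize_vec n \<in> leb n \<rightarrow>\<^sub>M (\<Pi>\<^sub>M i\<in>{..<n}. borel)"
    by (simp cong: measurable_cong_sets add: sets_leb)
qed

theorem rotation_invariant_prob_exists:
  assumes n: "1 \<le> n"
  shows "rotation_invariant_prob n
    (distr (uniform_measure (leb n) (pball n)) (sphere_space n) (normalize_vec n))"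
    (is "rotation_invariant_prob n (distr ?U _ ?N)")
proof -
  let ?mu = "distr ?U (sphere_space n) ?N"
  have U: "prob_space ?U"
    using pball_pos[OF n] pball_finite by (intro prob_space_uniform_measure) auto
  have mN: "?N \<in> measurable ?U (sphere_space n)"
    using normalize_vec_meas[OF n] by simp
  have E: "emeasure ?mu S = emeasure (leb n) (pball n \<inter> ?N -` S) / emeasure (leb n) (pball n)"
    if "S \<in> sets (sphere_space n)" for S
  proof -
    have "?N -` S \<inter> Rn n \<in> sets (leb n)"
      using measurable_sets[OF normalize_vec_meas[OF n] that] by (simp add: space_leb)
    moreover have "pball n \<inter> (?N -` S \<inter> Rn n) = pball n \<inter> ?N -` S"
      by (auto simp: pball_def)
    ultimately show ?thesis
      using that by (simp add: emeasure_distr[OF mN] space_leb)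
  qed
  have "distr ?mu ?mu (mat_app n Q) = ?mu" if Q: "orthogonal_mat n Q" for Q
  proof (rule measure_eqI)
    fix S assume "S \<in> sets (distr ?mu ?mu (mat_app n Q))"
    then have S: "S \<in> sets (sphere_space n)" by simp
    let ?T = "mat_app n Q -` S \<inter> esphere n"
    have mQ: "mat_app n Q \<in> measurable ?mu ?mu" using mat_app_sphere[OF Q] by simp
    have T: "?T \<in> sets (sphere_space n)"
      using measurable_sets[OF mat_app_sphere[OF Q] S] by (simp add: space_sphere_space)
    have N: "pball n \<inter> ?N -` S \<in> sets (leb n)"
    proof -
      have "pball n \<inter> (?N -` S \<inter> space (leb n)) \<in> sets (leb n)"
        using measurable_sets[OF normalize_vec_meas[OF n] S] by auto
      moreover have "pball n \<inter> (?N -` S \<inter> space (leb n)) = pball n \<inter> ?N -` S"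
        by (auto simp: pball_def space_leb)
      ultimately show ?thesis by simp
    qed
    have "pball n \<inter> ?N -` ?T = mat_app n Q -` (pball n \<inter> ?N -` S) \<inter> Rn n"
      using normalize_vec_esphere[OF n]
      by (auto simp: pball_def enorm_mat_app[OF Q] normalize_vec_mat_app[OF Q])
    then have "emeasure ?mu ?T = emeasure ?mu S"
      unfolding E[OF S] E[OF T] using leb_rotate[OF n Q N] by (simp only:)
    then show "emeasure (distr ?mu ?mu (mat_app n Q)) S = emeasure ?mu S"
      using S by (simp add: emeasure_distr[OF mQ] space_sphere_space)
  qed simp
  then show ?thesis
    unfolding rotation_invariant_prob_def using prob_space.prob_space_distr[OF U mN] by simp
qed

end

(*
  Write E = A D with D the unit ball and B = A^-1. Rotation invariance gives
  n M_E^2 = sum_j |B e_j|^2, so the m coordinates j with the smallest |B e_j| satisfy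
  sum_j |B e_j|^2 <= m M_E^2. On the span of these coordinates Cauchy-Schwarz gives
  |B y|^2 <= m M_E^2 |y|^2, so the integer points of length at most c2 / (sqrt m M_E) in this
  copy of R^m lie in E. For the binomial bound, the vectors with entries 0, 1, -1 and exactly
  k nonzero entries have squared length k.
*)

theory Submission
  imports Defs
begin

section \<open>Coordinate bounds and finiteness of sets of integer points\<close>

lemma abs_le_enorm: "i < n \<Longrightarrow> \<bar>x i\<bar> \<le> enorm n x"
  using member_le_L2_set[of "{..<n}" i "\<lambda>i. \<bar>x i\<bar>"] by (simp add: L2_set_def)

lemma enorm_sq: "(enorm n x)\<^sup>2 = (\<Sum>i<n. (x i)\<^sup>2)"
  by (simp add: L2_set_def sum_nonneg)

lemma enorm_divide: "enorm n (\<lambda>i\<in>{..<n}. x i / r) = enorm n x / \<bar>r\<bar>"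
  by (simp add: L2_set_def power_divide real_sqrt_divide flip: sum_divide_distrib)

lemma finite_bounded_Zn:
  assumes "X \<subseteq> Zn n" "\<And>x i. x \<in> X \<Longrightarrow> i < n \<Longrightarrow> \<bar>x i\<bar> \<le> C"
  shows "finite X"
proof (rule finite_subset)
  show "X \<subseteq> (\<Pi>\<^sub>E i\<in>{..<n}. {r. r \<in> \<int> \<and> \<bar>r\<bar> \<le> C})"
  proof
    fix x assume "x \<in> X"
    then show "x \<in> (\<Pi>\<^sub>E i\<in>{..<n}. {r. r \<in> \<int> \<and> \<bar>r\<bar> \<le> C})"
      using assms(1) assms(2)[of x] by (auto simp: Zn_def PiE_iff)
  qed
  show "finite (\<Pi>\<^sub>E i\<in>{..<n}. {r::real. r \<in> \<int> \<and> \<bar>r\<bar> \<le> C})"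
    by (intro finite_PiE) (auto simp: finite_abs_int_segment)
qed

lemma finite_eball_Zn: "finite (eball n t \<inter> Zn n)"
  by (rule finite_bounded_Zn[where C = t]) (auto simp: eball_def intro: order_trans[OF abs_le_enorm])

text \<open>\<open>card\<close> of an infinite set is 0, so comparing counts requires finiteness. An
  ellipsoid is bounded because its points are images of vectors whose coordinates are at most 1 in
  absolute value.\<close>

lemma finite_ellipsoid_Zn:
  assumes "is_ellipsoid n E"
  shows "finite (E \<inter> Zn n)"
proof -
  obtain A where A: "E = mat_app n A ` eball n 1"
    using assms by (auto simp: is_ellipsoid_def)
  show ?thesis
  proof (rule finite_bounded_Zn[where C = "\<Sum>i<n. \<Sum>j<n. \<bar>A i j\<bar>"])
    fix y i assume "y \<in> E \<inter> Zn n" and i: "i < n"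
    then obtain x where x: "x \<in> eball n 1" "y = mat_app n A x" by (auto simp: A)
    have "\<bar>y i\<bar> \<le> (\<Sum>j<n. \<bar>A i j * x j\<bar>)"
      using i by (simp add: x mat_app_def)
    also have "\<dots> \<le> (\<Sum>j<n. \<bar>A i j\<bar>)"
    proof (rule sum_mono)
      fix j assume "j \<in> {..<n}"
      then have "\<bar>x j\<bar> \<le> 1" using x abs_le_enorm[of j n x] by (auto simp: eball_def)
      then show "\<bar>A i j * x j\<bar> \<le> \<bar>A i j\<bar>" by (simp add: abs_mult mult_left_le)
    qed
    \<comment> \<open>Summing over all rows gives a bound that does not depend on
      \<open>i\<close>.\<close>
    also have "\<dots> \<le> (\<Sum>i<n. \<Sum>j<n. \<bar>A i j\<bar>)"
      using i by (intro member_le_sum[where f = "\<lambda>i. \<Sum>j<n. \<bar>A i j\<bar>"]) (auto intro: sum_nonneg)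
    finally show "\<bar>y i\<bar> \<le> (\<Sum>i<n. \<Sum>j<n. \<bar>A i j\<bar>)" .
  qed auto
qed

section \<open>Ellipsoids and their norms in terms of the inverse matrix\<close>

text \<open>The columns of \<open>B\<close> are preimages under \<open>A\<close> of the standard
  basis vectors, which exist by surjectivity.\<close>

lemma mat_app_right_inverse:
  assumes "bij_betw (mat_app n A) (Rn n) (Rn n)"
  obtains B where "\<And>x. x \<in> Rn n \<Longrightarrow> mat_app n A (mat_app n B x) = x"
proof -
  define e where "e = (\<lambda>j. \<lambda>i\<in>{..<n}. if i = j then 1 else 0 :: real)"
  \<comment> \<open>For \<open>j \<ge> n\<close> the vector \<open>e j\<close> is zero and still
    lies in \<open>Rn n\<close>, so preimages can be chosen for all \<open>j\<close> at
    once.\<close>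
  have "\<exists>z. mat_app n A z = e j" for j
  proof -
    have "e j \<in> Rn n" by (simp add: e_def Rn_def)
    then show ?thesis using assms by (metis bij_betw_imp_surj_on imageE)
  qed
  then obtain T where T: "mat_app n A (T j) = e j" for j by metis
  define B where "B = (\<lambda>i j. T j i)"
  have "mat_app n A (mat_app n B x) = x" if x: "x \<in> Rn n" for x
  proof
    fix i
    show "mat_app n A (mat_app n B x) i = x i"
    proof (cases "i < n")
      case True
      have "mat_app n A (mat_app n B x) i = (\<Sum>j<n. \<Sum>k<n. A i j * B j k * x k)"
        using True by (simp add: mat_app_def sum_distrib_left mult.assoc)
      also have "\<dots> = (\<Sum>k<n. \<Sum>j<n. A i j * B j k * x k)" by (rule sum.swap)
      also have "\<dots> = (\<Sum>k<n. mat_app n A (T k) i * x k)"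
        using True by (simp add: mat_app_def B_def sum_distrib_right)
      also have "\<dots> = (\<Sum>k<n. if i = k then x k else 0)"
        using True by (intro sum.cong) (auto simp: T e_def)
      also have "\<dots> = x i" using True by simp
      finally show ?thesis .
    next
      case False
      then show ?thesis using x by (auto simp: mat_app_def Rn_def PiE_def extensional_def)
    qed
  qed
  then show thesis by (rule that)
qed

text \<open>Injectivity of \<open>A\<close> turns the right inverse \<open>B\<close> into a left
  inverse on \<open>Rn n\<close>, so the image of the unit ball under \<open>A\<close> is its
  preimage under \<open>B\<close>.\<close>

lemma mem_ellipsoid_iff:
  assumes "bij_betw (mat_app n A) (Rn n) (Rn n)"
    and "\<And>x. x \<in> Rn n \<Longrightarrow> mat_app n A (mat_app n B x) = x"
    and "x \<in> Rn n"
  shows "x \<in> mat_app n A ` eball n 1 \<longleftrightarrow> enorm n (mat_app n B x) \<le> 1"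
proof
  assume "x \<in> mat_app n A ` eball n 1"
  then obtain z where z: "z \<in> eball n 1" "x = mat_app n A z" by auto
  have "mat_app n B x = z"
  proof (rule inj_onD)
    show "inj_on (mat_app n A) (Rn n)" using assms(1) by (rule bij_betw_imp_inj_on)
    show "mat_app n A (mat_app n B x) = mat_app n A z" using assms(2,3) z by simp
  qed (use z in \<open>auto simp: eball_def\<close>)
  then show "enorm n (mat_app n B x) \<le> 1" using z by (simp add: eball_def)
next
  assume "enorm n (mat_app n B x) \<le> 1"
  then have "mat_app n B x \<in> eball n 1" by (simp add: eball_def)
  then show "x \<in> mat_app n A ` eball n 1" using assms(2)[OF assms(3)] by force
qed

text \<open>Evaluates the Minkowski functional. The case \<open>a = 0\<close> is separate because
  the set is then an open half-line and the infimum is not attained.\<close>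

lemma Inf_pos_atLeast:
  fixes a :: real
  assumes "0 \<le> a"
  shows "Inf {r. 0 < r \<and> a \<le> r} = a"
proof (cases "a = 0")
  case True
  then have "{r. 0 < r \<and> a \<le> r} = {0<..}" by auto
  then show ?thesis using True by simp
next
  case False
  then have "{r. 0 < r \<and> a \<le> r} = {a..}" using assms by auto
  then show ?thesis by simp
qed

text \<open>By homogeneity, \<open>x / r\<close> lies in the ellipsoid exactly when
  \<open>B x\<close> has length at most \<open>r\<close>.\<close>

lemma norm_of_ellipsoid:
  assumes "bij_betw (mat_app n A) (Rn n) (Rn n)"
    and "\<And>x. x \<in> Rn n \<Longrightarrow> mat_app n A (mat_app n B x) = x"
  shows "norm_of n (mat_app n A ` eball n 1) x = enorm n (mat_app n B x)"
proof -
  have "(\<lambda>i\<in>{..<n}. x i / r) \<in> mat_app n A ` eball n 1 \<longleftrightarrow> enorm n (mat_app n B x) \<le> r"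
    if "0 < r" for r
  proof -
    have "(\<lambda>i\<in>{..<n}. x i / r) \<in> Rn n" by (simp add: Rn_def)
    moreover have "mat_app n B (\<lambda>i\<in>{..<n}. x i / r) = (\<lambda>i\<in>{..<n}. mat_app n B x i / r)"
      by (auto simp: mat_app_def fun_eq_iff sum_divide_distrib)
    ultimately show ?thesis
      using that by (simp add: mem_ellipsoid_iff[OF assms] enorm_divide)
  qed
  then have "norm_of n (mat_app n A ` eball n 1) x = Inf {r. 0 < r \<and> enorm n (mat_app n B x) \<le> r}"
    unfolding norm_of_def by (metis (lifting))
  then show ?thesis by (simp add: Inf_pos_atLeast)
qed

section \<open>Second moments of the rotation invariant measure, and the value of
  \<open>M_of\<close>\<close>

text \<open>On the sphere all coordinates are bounded by 1, so their products are integrable for a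
  probability measure. The last fact is the change of variables \<open>x \<mapsto> Q x\<close>,
  which leaves the measure fixed.\<close>

lemma
  assumes "rotation_invariant_prob n \<mu>"
  shows space_rotation_invariant: "space \<mu> = esphere n"
    and sphere_integrable: "i < n \<Longrightarrow> j < n \<Longrightarrow> integrable \<mu> (\<lambda>x. x i * x j)"
    and sphere_rotate: "orthogonal_mat n Q \<Longrightarrow> i < n \<Longrightarrow> j < n \<Longrightarrow>
      (\<integral>x. mat_app n Q x i * mat_app n Q x j \<partial>\<mu>) = (\<integral>x. x i * x j \<partial>\<mu>)"
proof -
  have S: "sets \<mu> = sets (sphere_space n)" and "prob_space \<mu>"
    and D: "orthogonal_mat n Q \<Longrightarrow> distr \<mu> \<mu> (mat_app n Q) = \<mu>"
    using assms by (auto simp: rotation_invariant_prob_def)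
  interpret prob_space \<mu> by fact
  show sp: "space \<mu> = esphere n"
    using sets_eq_imp_space_eq[OF S] by (simp add: space_sphere_space)
  have m: "(\<lambda>x. x i * x j) \<in> borel_measurable \<mu>" if "i < n" "j < n" for i j
  proof -
    have "(\<lambda>x. x i * x j) \<in> borel_measurable (\<Pi>\<^sub>M i\<in>{..<n}. borel :: real measure)"
      using that by (intro borel_measurable_times measurable_component_singleton) auto
    then have "(\<lambda>x. x i * x j) \<in> borel_measurable (sphere_space n)"
      by (rule measurable_restrict_space1)
    then show ?thesis by (simp cong: measurable_cong_sets add: S)
  qed
  show "integrable \<mu> (\<lambda>x. x i * x j)" if "i < n" "j < n"
  proof (rule integrable_const_bound[where B = 1])
    have "norm (x i * x j) \<le> 1" if "x \<in> space \<mu>" for x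
    proof -
      have "\<bar>x i\<bar> \<le> 1" "\<bar>x j\<bar> \<le> 1"
        using that \<open>i < n\<close> \<open>j < n\<close> abs_le_enorm[of i n x] abs_le_enorm[of j n x]
        by (auto simp: sp esphere_def)
      then show ?thesis by (simp add: abs_mult mult_le_one)
    qed
    then show "AE x in \<mu>. norm (x i * x j) \<le> 1" by simp
  qed (rule m[OF that])
  show "(\<integral>x. mat_app n Q x i * mat_app n Q x j \<partial>\<mu>) = (\<integral>x. x i * x j \<partial>\<mu>)"
    if Q: "orthogonal_mat n Q" and ij: "i < n" "j < n"
  proof -
    have "mat_app n Q \<in> measurable \<mu> \<mu>"
      using mat_app_sphere[OF Q] by (simp cong: measurable_cong_sets add: S)
    from integral_distr[OF this m[OF ij]] show ?thesis by (simp add: D[OF Q])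
  qed
qed

text \<open>These are the only rotations used to compute moments: sign changes treat the mixed
  moments and coordinate swaps the diagonal ones.\<close>

lemma orthogonal_mat_signed_perm:
  assumes p: "p permutes {..<n}" and s: "\<And>i. (s i)\<^sup>2 = (1::real)"
  shows "orthogonal_mat n (\<lambda>i j. if j = p i then s i else 0)"
proof -
  have pn: "p i < n \<longleftrightarrow> i < n" for i using permutes_in_image[OF p, of i] by simp
  have ss: "s i * s i = 1" for i using s[of i] by (simp add: power2_eq_square)
  have col: "(\<Sum>k<n. (if i = p k then s k else 0) * (if j = p k then s k else 0)) =
      (if i = j then 1 else 0)" if "i < n" for i j
  proof -
    have "(\<Sum>k<n. (if i = p k then s k else 0) * (if j = p k then s k else 0)) =
        (\<Sum>k<n. if p k = i then (if i = j then 1 else 0) else (0::real))"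
      by (intro sum.cong) (auto simp: ss)
    \<comment> \<open>Reindexing along the permutation \<open>p\<close> replaces \<open>p k\<close>
      by \<open>k\<close>.\<close>
    also have "\<dots> = (\<Sum>k<n. if k = i then (if i = j then 1 else 0) else (0::real))"
      by (subst (2) sum.permute[OF p]) (simp add: o_def)
    also have "\<dots> = (if i = j then 1 else 0)" using that by simp
    finally show ?thesis .
  qed
  have row: "(\<Sum>k<n. (if k = p i then s i else 0) * (if k = p j then s j else 0)) =
      (if i = j then 1 else 0)" if "i < n" for i j
  proof -
    have "(\<Sum>k<n. (if k = p i then s i else 0) * (if k = p j then s j else 0)) =
        (\<Sum>k<n. if k = p i then (if i = j then 1 else 0) else (0::real))"
      using permutes_inj[OF p] by (intro sum.cong) (auto simp: ss dest: injD)
    also have "\<dots> = (if i = j then 1 else 0)" using that pn by simp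
    finally show ?thesis .
  qed
  show ?thesis unfolding orthogonal_mat_def using col row by auto
qed

lemma mat_app_signed_perm:
  assumes "p permutes {..<n}" "i < n"
  shows "mat_app n (\<lambda>i j. if j = p i then s i else 0) x i = s i * x (p i)"
proof -
  have "p i < n" using permutes_in_image[OF assms(1), of i] assms(2) by simp
  moreover have "(\<Sum>j<n. (if j = p i then s i else 0) * x j) =
      (\<Sum>j<n. if j = p i then s i * x j else 0)"
    by (intro sum.cong) auto
  ultimately show ?thesis using assms(2) by (simp add: mat_app_def)
qed

text \<open>Changing the sign of one coordinate negates a mixed moment, which is therefore 0.
  Swapping coordinates shows that the \<open>n\<close> diagonal moments agree, and they add up to
  the integral of the squared length, which is 1.\<close>

lemma sphere_moment:
  assumes \<mu>: "rotation_invariant_prob n \<mu>" and ij: "i < n" "j < n"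
  shows "(\<integral>x. x i * x j \<partial>\<mu>) = (if i = j then 1 / real n else 0)"
proof -
  interpret prob_space \<mu> using \<mu> by (simp add: rotation_invariant_prob_def)
  show ?thesis
  proof (cases "i = j")
    case False
    define s where "s = (\<lambda>k. if k = i then -1 else 1 :: real)"
    have p: "id permutes {..<n}" by (rule permutes_id)
    have "orthogonal_mat n (\<lambda>i j. if j = id i then s i else 0)"
      by (rule orthogonal_mat_signed_perm[OF p]) (simp add: s_def)
    from sphere_rotate[OF \<mu> this ij]
    have "(\<integral>x. - (x i * x j) \<partial>\<mu>) = (\<integral>x. x i * x j \<partial>\<mu>)"
      using False unfolding mat_app_signed_perm[OF p ij(1)] mat_app_signed_perm[OF p ij(2)]
      by (simp add: s_def)
    then show ?thesis using False by simp
  next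
    case True
    have eq: "(\<integral>x. x k * x k \<partial>\<mu>) = (\<integral>x. x i * x i \<partial>\<mu>)" if "k < n" for k
    proof -
      have p: "Transposition.transpose i k permutes {..<n}" using that ij by (intro permutes_swap_id) auto
      have "orthogonal_mat n (\<lambda>a b. if b = Transposition.transpose i k a then 1 else 0)"
        by (rule orthogonal_mat_signed_perm[OF p]) simp
      from sphere_rotate[OF \<mu> this ij(1) ij(1)] show ?thesis
        unfolding mat_app_signed_perm[OF p ij(1)] by simp
    qed
    have "real n * (\<integral>x. x i * x i \<partial>\<mu>) = (\<Sum>k<n. \<integral>x. x k * x k \<partial>\<mu>)"
      by (simp add: eq)
    also have "\<dots> = (\<integral>x. (\<Sum>k<n. x k * x k) \<partial>\<mu>)"
      by (intro Bochner_Integration.integral_sum[symmetric] sphere_integrable[OF \<mu>]) auto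
    also have "\<dots> = (\<integral>x. 1 \<partial>\<mu>)"
    proof (rule Bochner_Integration.integral_cong[OF refl])
      fix x assume "x \<in> space \<mu>"
      then have "enorm n x = 1" by (simp add: space_rotation_invariant[OF \<mu>] esphere_def)
      then show "(\<Sum>k<n. x k * x k) = 1"
        using enorm_sq[of x n] by (simp add: power2_eq_square)
    qed
    also have "\<dots> = 1" by (simp add: prob_space)
    finally show ?thesis using True ij by (simp add: field_simps)
  qed
qed

text \<open>The right side is the squared Hilbert-Schmidt norm of \<open>B\<close> over
  \<open>n\<close>: expand the squared length of \<open>B x\<close> as a quadratic form and insert
  the second moments, so that only the diagonal terms survive.\<close>

lemma M_of_ellipsoid:
  assumes "rotation_invariant_prob n \<mu>"
    and "bij_betw (mat_app n A) (Rn n) (Rn n)"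
    and "\<And>x. x \<in> Rn n \<Longrightarrow> mat_app n A (mat_app n B x) = x"
  shows "(M_of n \<mu> (mat_app n A ` eball n 1))\<^sup>2 = (\<Sum>j<n. \<Sum>i<n. (B i j)\<^sup>2) / real n"
proof -
  have eq: "(norm_of n (mat_app n A ` eball n 1) x)\<^sup>2 =
      (\<Sum>i<n. \<Sum>j<n. \<Sum>k<n. B i j * B i k * (x j * x k))" for x
    by (simp add: norm_of_ellipsoid[OF assms(2,3)] enorm_sq)
      (simp add: mat_app_def power2_eq_square sum_product mult_ac)
  have "(M_of n \<mu> (mat_app n A ` eball n 1))\<^sup>2 =
      (\<integral>x. (\<Sum>i<n. \<Sum>j<n. \<Sum>k<n. B i j * B i k * (x j * x k)) \<partial>\<mu>)"
    unfolding M_of_def eq[symmetric] by (intro real_sqrt_pow2 Bochner_Integration.integral_nonneg) simp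
  also have "\<dots> = (\<Sum>i<n. \<Sum>j<n. \<Sum>k<n. B i j * B i k * (\<integral>x. x j * x k \<partial>\<mu>))"
  proof -
    have int: "integrable \<mu> (\<lambda>x. B i j * B i k * (x j * x k))" if "j < n" "k < n" for i j k
      using sphere_integrable[OF assms(1) that] by (rule integrable_mult_right)
    show ?thesis
      \<comment> \<open>The repetition moves the integral through the three sums one after another;
        then only a constant factor has to be pulled out.\<close>
      by (subst Bochner_Integration.integral_sum,
          (intro Bochner_Integration.integrable_sum int; simp), intro sum.cong refl)+
        (rule integral_mult_right_zero)
  qed
  also have "\<dots> = (\<Sum>i<n. \<Sum>j<n. \<Sum>k<n. if j = k then (B i j)\<^sup>2 / real n else 0)"
    by (intro sum.cong) (auto simp: sphere_moment[OF assms(1)] power2_eq_square)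
  also have "\<dots> = (\<Sum>i<n. \<Sum>j<n. (B i j)\<^sup>2) / real n"
    by (simp add: sum_divide_distrib)
  also have "(\<Sum>i<n. \<Sum>j<n. (B i j)\<^sup>2) = (\<Sum>j<n. \<Sum>i<n. (B i j)\<^sup>2)" by (rule sum.swap)
  finally show ?thesis .
qed

section \<open>Selection of short columns and embedding of the \<open>m\<close>-dimensional
  ball\<close>

text \<open>Discard a largest value until \<open>m\<close> elements remain. Since \<open>a\<close>
  is only an upper bound for the average, the hypothesis passes unchanged to the smaller set, which
  makes the induction work.\<close>

lemma exists_subset_sum_le_average:
  fixes q :: "'a \<Rightarrow> real"
  assumes "finite S" "sum q S \<le> real (card S) * a" "m \<le> card S"
  shows "\<exists>T\<subseteq>S. card T = m \<and> sum q T \<le> real m * a"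
  using assms
proof (induction "card S - m" arbitrary: S)
  case 0
  then show ?case by (intro exI[of _ S]) auto
next
  case (Suc d)
  then have "S \<noteq> {}" by auto
  obtain s where s: "s \<in> S" "\<And>t. t \<in> S \<Longrightarrow> q t \<le> q s"
    using obtains_MAX[OF Suc.prems(1) \<open>S \<noteq> {}\<close>, of q] Suc.prems(1) by (metis Max_ge finite_imageI imageI)
  have c: "card S = Suc (card (S - {s}))"
    using Suc.prems(1) s(1) by (metis card.remove)
  have split: "sum q S = q s + sum q (S - {s})"
    using Suc.prems(1) s(1) by (rule sum.remove)
  have "sum q (S - {s}) \<le> real (card (S - {s})) * a"
  \<comment> \<open>If the largest value is at least \<open>a\<close>, the sum drops by at least
    \<open>a\<close>; otherwise every remaining value is at most \<open>a\<close>.\<close>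
  proof (cases "a \<le> q s")
    case True
    then show ?thesis using Suc.prems(2) split c by (simp add: algebra_simps)
  next
    case False
    then have "q t \<le> a" if "t \<in> S - {s}" for t using s(2)[of t] that by auto
    then show ?thesis by (rule sum_bounded_above)
  qed
  moreover have "d = card (S - {s}) - m" "m \<le> card (S - {s})"
    using Suc.hyps(2) c by auto
  ultimately obtain T where "T \<subseteq> S - {s}" "card T = m" "sum q T \<le> real m * a"
    using Suc.hyps(1)[of "S - {s}"] Suc.prems(1) by auto
  then show ?case by blast
qed

text \<open>Cauchy-Schwarz in each row, then summation over the rows: the operator norm of the
  submatrix with columns in \<open>T\<close> is at most its Hilbert-Schmidt norm.\<close>

lemma enorm_mat_app_le_supported:
  assumes T: "T \<subseteq> {..<n}" and y: "\<And>j. j < n \<Longrightarrow> j \<notin> T \<Longrightarrow> y j = 0"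
  shows "(enorm n (mat_app n B y))\<^sup>2 \<le> (\<Sum>j\<in>T. \<Sum>i<n. (B i j)\<^sup>2) * (enorm n y)\<^sup>2"
proof -
  have ny: "(enorm n y)\<^sup>2 = (\<Sum>j\<in>T. (y j)\<^sup>2)"
    unfolding enorm_sq using T y by (intro sum.mono_neutral_right) auto
  have "(enorm n (mat_app n B y))\<^sup>2 = (\<Sum>i<n. (\<Sum>j\<in>T. B i j * y j)\<^sup>2)"
    unfolding enorm_sq
  proof (rule sum.cong[OF refl])
    fix i assume "i \<in> {..<n}"
    moreover have "(\<Sum>j<n. B i j * y j) = (\<Sum>j\<in>T. B i j * y j)"
      using T y by (intro sum.mono_neutral_right) auto
    ultimately show "(mat_app n B y i)\<^sup>2 = (\<Sum>j\<in>T. B i j * y j)\<^sup>2"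
      by (simp add: mat_app_def)
  qed
  also have "\<dots> \<le> (\<Sum>i<n. (\<Sum>j\<in>T. (B i j)\<^sup>2) * (\<Sum>j\<in>T. (y j)\<^sup>2))"
    by (intro sum_mono Cauchy_Schwarz_ineq_sum)
  also have "\<dots> = (\<Sum>j\<in>T. \<Sum>i<n. (B i j)\<^sup>2) * (enorm n y)\<^sup>2"
    unfolding ny by (subst sum.swap) (simp flip: sum_distrib_right)
  finally show ?thesis .
qed

text \<open>Padding with zeros outside \<open>m\<close> well chosen coordinates preserves length and
  integrality and is injective, so it suffices that the padded ball lies in
  \<open>E\<close>.\<close>

lemma ball_count_le_card_ellipsoid:
  assumes \<mu>: "rotation_invariant_prob n \<mu>" and E: "is_ellipsoid n E" and mn: "m \<le> n" "n \<noteq> 0"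
    and t: "0 \<le> t" "real m * (M_of n \<mu> E)\<^sup>2 * t\<^sup>2 \<le> 1"
  shows "ball_count t m \<le> card (E \<inter> Zn n)"
proof -
  obtain A where A: "bij_betw (mat_app n A) (Rn n) (Rn n)" "E = mat_app n A ` eball n 1"
    using E by (auto simp: is_ellipsoid_def)
  obtain B where B: "\<And>x. x \<in> Rn n \<Longrightarrow> mat_app n A (mat_app n B x) = x"
    using mat_app_right_inverse[OF A(1)] by blast
  define M where "M = M_of n \<mu> E"
  have M: "M\<^sup>2 = (\<Sum>j<n. \<Sum>i<n. (B i j)\<^sup>2) / real n"
    unfolding M_def A(2) by (rule M_of_ellipsoid[OF \<mu> A(1) B])
  \<comment> \<open>By the formula for \<open>M\<^sup>2\<close>, the squared lengths of the
    \<open>n\<close> columns of \<open>B\<close> have average \<open>M\<^sup>2\<close>.\<close>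
  have "\<exists>T\<subseteq>{..<n}. card T = m \<and> (\<Sum>j\<in>T. \<Sum>i<n. (B i j)\<^sup>2) \<le> real m * M\<^sup>2"
    using mn by (intro exists_subset_sum_le_average) (auto simp: M)
  then obtain T where T: "T \<subseteq> {..<n}" "card T = m" "(\<Sum>j\<in>T. \<Sum>i<n. (B i j)\<^sup>2) \<le> real m * M\<^sup>2"
    by blast
  have "finite T" using T(1) finite_subset by blast
  then obtain \<phi> where \<phi>: "bij_betw \<phi> T {..<m}"
    using T(2) by (metis card_lessThan finite_lessThan finite_same_card_bij)
  define F where "F = (\<lambda>x. \<lambda>i\<in>{..<n}. if i \<in> T then x (\<phi> i) else (0::real))"
  have F_norm: "enorm n (F x) = enorm m x" for x
  proof -
    have "(\<Sum>i<n. (F x i)\<^sup>2) = (\<Sum>i\<in>T. (x (\<phi> i))\<^sup>2)"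
      using T(1) by (intro sum.mono_neutral_cong_right) (auto simp: F_def)
    also have "\<dots> = (\<Sum>i<m. (x i)\<^sup>2)" by (rule sum.reindex_bij_betw[OF \<phi>])
    finally show ?thesis by (simp add: L2_set_def)
  qed
  have "F x \<in> E \<inter> Zn n" if x: "x \<in> eball m t \<inter> Zn m" for x
  proof
    have "\<phi> i < m" if "i \<in> T" for i using \<phi> that by (auto simp: bij_betw_def)
    then show "F x \<in> Zn n" using x by (auto simp: F_def Zn_def PiE_iff)
    have "(enorm n (mat_app n B (F x)))\<^sup>2 \<le> (\<Sum>j\<in>T. \<Sum>i<n. (B i j)\<^sup>2) * (enorm n (F x))\<^sup>2"
      by (rule enorm_mat_app_le_supported[OF T(1)]) (simp add: F_def)
    also have "\<dots> \<le> (real m * M\<^sup>2) * t\<^sup>2"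
      using x T(3) t(1) by (intro mult_mono power_mono) (auto simp: F_norm eball_def)
    also have "\<dots> \<le> 1\<^sup>2" using t(2) by (simp add: M_def)
    finally have "enorm n (mat_app n B (F x)) \<le> 1" by (rule power2_le_imp_le) simp
    moreover have "F x \<in> Rn n" by (simp add: F_def Rn_def)
    ultimately show "F x \<in> E" using mem_ellipsoid_iff[OF A(1) B] A(2) by simp
  qed
  moreover have "inj_on F (eball m t \<inter> Zn m)"
  proof (rule inj_onI)
    fix x y assume xy: "x \<in> eball m t \<inter> Zn m" "y \<in> eball m t \<inter> Zn m" "F x = F y"
    show "x = y"
    proof (rule PiE_ext)
      show "x \<in> (\<Pi>\<^sub>E i\<in>{..<m}. \<int>)" "y \<in> (\<Pi>\<^sub>E i\<in>{..<m}. \<int>)" using xy by (auto simp: Zn_def)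
      fix k assume "k \<in> {..<m}"
      then obtain i where i: "i \<in> T" "k = \<phi> i" using \<phi> by (auto simp: bij_betw_def)
      then show "x k = y k" using fun_cong[OF xy(3), of i] T(1) by (auto simp: F_def)
    qed
  qed
  ultimately show ?thesis
    unfolding ball_count_def using finite_ellipsoid_Zn[OF E]
    by (intro card_inj_on_le[of F]) auto
qed

section \<open>Counting sign vectors in a ball\<close>

lemma binomial_le_ball_count:
  assumes "0 \<le> t" "real k \<le> t\<^sup>2"
  shows "(m choose k) * 2 ^ k \<le> ball_count t m"
proof -
  \<comment> \<open>\<open>S\<close> encodes the support of a sign vector and \<open>U\<close> the
    positions of the entries 1. For \<open>k > m\<close> there is no such \<open>S\<close>, in
    agreement with the binomial coefficient being 0.\<close>
  define P where "P = (SIGMA S:{S. S \<subseteq> {..<m} \<and> card S = k}. Pow S)"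
  define F where
    "F = (\<lambda>(S, U). \<lambda>i\<in>{..<m}. if i \<in> U then 1 else if i \<in> S then -1 else (0::real))"
  have fin: "finite S" if "S \<subseteq> {..<m}" for S :: "nat set"
    using that finite_subset by blast
  have "card P = (\<Sum>S | S \<subseteq> {..<m} \<and> card S = k. 2 ^ k)"
    unfolding P_def using fin by (subst card_SigmaI) (auto simp: card_Pow)
  also have "\<dots> = (m choose k) * 2 ^ k" by (simp add: n_subsets)
  finally have "(m choose k) * 2 ^ k = card P" ..
  also have "\<dots> \<le> card (eball m t \<inter> Zn m)"
  proof (rule card_inj_on_le[OF _ _ finite_eball_Zn])
    show "inj_on F P"
    proof (rule inj_onI)
      fix a b assume ab: "a \<in> P" "b \<in> P" and eq: "F a = F b"
      obtain S U where a: "a = (S, U)" by (cases a)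
      obtain S' U' where b: "b = (S', U')" by (cases b)
      have sub: "U \<subseteq> S" "S \<subseteq> {..<m}" "U' \<subseteq> S'" "S' \<subseteq> {..<m}"
        using ab by (auto simp: P_def a b)
      \<comment> \<open>The vector determines both sets: its entry is 1 exactly on \<open>U\<close>
        and nonzero exactly on \<open>S\<close>.\<close>
      have "(i \<in> U \<longleftrightarrow> i \<in> U') \<and> (i \<in> S \<longleftrightarrow> i \<in> S')" if "i < m" for i
        using fun_cong[OF eq, of i] that sub
        by (auto simp: F_def a b split: if_splits)
      then show "a = b" using sub unfolding a b by blast
    qed
    show "F ` P \<subseteq> eball m t \<inter> Zn m"
    proof
      fix x assume "x \<in> F ` P"
      then obtain S U where SU: "U \<subseteq> S" "S \<subseteq> {..<m}" "card S = k" and x: "x = F (S, U)"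
        by (auto simp: P_def)
      have "(enorm m x)\<^sup>2 = (\<Sum>i\<in>S. 1)"
        unfolding enorm_sq x F_def using SU
        by (intro sum.mono_neutral_cong_right) auto
      also have "\<dots> \<le> t\<^sup>2" using SU assms(2) by simp
      finally have "enorm m x \<le> t" using assms(1) by (rule power2_le_imp_le)
      then show "x \<in> eball m t \<inter> Zn m" by (auto simp: x F_def eball_def Rn_def Zn_def)
    qed
  qed
  finally show ?thesis by (simp add: ball_count_def)
qed

section \<open>Choice of the constants and comparison of the maxima\<close>

theorem mainTheorem7:
  shows "\<exists>c1 c2 :: real. 0 < c1 \<and> 0 < c2 \<and> c2 < 1 \<and>
    (\<forall>n::nat. \<forall>\<mu> E. 1 \<le> n \<longrightarrow> rotation_invariant_prob n \<mu> \<longrightarrow> is_ellipsoid n E \<longrightarrow>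
       M_of n \<mu> E < c2 \<longrightarrow>
       (let M = M_of n \<mu> E;
            I = {m::nat. 1 \<le> m \<and> real m \<le> c1 * sqrt (real n)};
            k = (\<lambda>m. nat \<lfloor>c2\<^sup>2 / (real m * M\<^sup>2)\<rfloor>)
        in I \<noteq> {} \<longrightarrow>
             card (E \<inter> Zn n) \<ge> Max ((\<lambda>m. ball_count (c2 / (sqrt (real m) * M)) m) ` I) \<and>
             Max ((\<lambda>m. ball_count (c2 / (sqrt (real m) * M)) m) ` I)
               \<ge> Max ((\<lambda>m. (m choose k m) * 2 ^ k m) ` I)))"
\<comment> \<open>With \<open>c1 = 1\<close> one has m \<le> sqrt n \<le> n, so \<open>m\<close>
  coordinates can be selected. Any \<open>c2\<close> in (0, 1) would serve, since the radius enters
  only through m M^2 t^2 \<le> c2^2 \<le> 1.\<close>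
proof (rule exI[of _ 1], rule exI[of _ "1/2"], intro conjI allI impI)
  fix n :: nat and \<mu> E
  assume n: "1 \<le> n" and \<mu>: "rotation_invariant_prob n \<mu>" and E: "is_ellipsoid n E"
  define M where "M = M_of n \<mu> E"
  define I where "I = {m::nat. 1 \<le> m \<and> real m \<le> 1 * sqrt (real n)}"
  define k where "k = (\<lambda>m. nat \<lfloor>(1/2)\<^sup>2 / (real m * M\<^sup>2)\<rfloor>)"
  define t where "t = (\<lambda>m. (1/2) / (sqrt (real m) * M))"
  \<comment> \<open>Nonnegativity suffices below: since x / 0 = 0, the value \<open>M = 0\<close>
    would give \<open>t m = 0\<close> and \<open>k m = 0\<close>, and both bounds still go
    through.\<close>
  have "0 \<le> M" by (simp add: M_def M_of_def)
  then have t0: "0 \<le> t m" for m by (simp add: t_def)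
  \<comment> \<open>The squared radius is exactly the number whose integer part is
    \<open>k m\<close>; this links the two lower bounds.\<close>
  have tsq: "(t m)\<^sup>2 = (1/2)\<^sup>2 / (real m * M\<^sup>2)" for m
    by (simp add: t_def power_divide power_mult_distrib)
  have le: "m \<le> n" if "m \<in> I" for m
  proof -
    have "real m \<le> sqrt (real n)" using that by (simp add: I_def)
    also have "\<dots> \<le> real n" using n by (intro real_le_lsqrt) (auto simp: power2_eq_square)
    finally show ?thesis by simp
  qed
  then have "I \<subseteq> {..n}" by auto
  \<comment> \<open>Finiteness, together with \<open>I \<noteq> {}\<close>, makes each
    \<open>Max\<close> a genuine maximum.\<close>
  then have fin: "finite I" using finite_subset by blast
  have first: "ball_count (t m) m \<le> card (E \<inter> Zn n)" if "m \<in> I" for m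
  proof (rule ball_count_le_card_ellipsoid[OF \<mu> E le[OF that] _ t0])
    show "real m * (M_of n \<mu> E)\<^sup>2 * (t m)\<^sup>2 \<le> 1"
      unfolding tsq M_def[symmetric] by (simp add: power2_eq_square)
  qed (use n in simp)
  have second: "(m choose k m) * 2 ^ k m \<le> ball_count (t m) m" for m
  proof (rule binomial_le_ball_count[OF t0])
    show "real (k m) \<le> (t m)\<^sup>2" unfolding tsq k_def by (intro of_nat_floor) simp
  qed
  have "Max ((\<lambda>m. ball_count (t m) m) ` I) \<le> card (E \<inter> Zn n) \<and>
      Max ((\<lambda>m. (m choose k m) * 2 ^ k m) ` I) \<le> Max ((\<lambda>m. ball_count (t m) m) ` I)"
    if "I \<noteq> {}"
  proof
    show "Max ((\<lambda>m. ball_count (t m) m) ` I) \<le> card (E \<inter> Zn n)"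
      using fin that first by (intro Max.boundedI) auto
    have "(m choose k m) * 2 ^ k m \<le> Max ((\<lambda>m. ball_count (t m) m) ` I)" if "m \<in> I" for m
      using fin that by (intro order_trans[OF second] Max_ge) auto
    then show "Max ((\<lambda>m. (m choose k m) * 2 ^ k m) ` I) \<le> Max ((\<lambda>m. ball_count (t m) m) ` I)"
      using fin that by (intro Max.boundedI) auto
  qed
  then show "let M = M_of n \<mu> E;
            I = {m::nat. 1 \<le> m \<and> real m \<le> 1 * sqrt (real n)};
            k = (\<lambda>m. nat \<lfloor>(1/2)\<^sup>2 / (real m * M\<^sup>2)\<rfloor>)
        in I \<noteq> {} \<longrightarrow>
             card (E \<inter> Zn n) \<ge> Max ((\<lambda>m. ball_count ((1/2) / (sqrt (real m) * M)) m) ` I) \<and>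
             Max ((\<lambda>m. ball_count ((1/2) / (sqrt (real m) * M)) m) ` I)
               \<ge> Max ((\<lambda>m. (m choose k m) * 2 ^ k m) ` I)"
    unfolding Let_def M_def[symmetric] I_def[symmetric] t_def k_def by blast
qed simp_all

end
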